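(* Let $M$ be an $L$-module. If $N\in M$ is a pseudo-primary element and $S_p(N)$ is a prime element of $M$ for some $p\in V((N:I_M))$, then $rad(N)$ is a prime element of $M$.
   Context: A multiplicative lattice $L$ is a complete lattice (least element $0$, greatest element $1$) with a commutative, associative multiplication that distributes over arbitrary joins and has $1$ as identity. An element $a$ of a complete lattice is compact if $a\leqslant \bigvee X$ implies $a\leqslant x_1\vee\cdots\vee x_n$ for finitely many $x_i\in X$. Standing assumption: every element of $L$ is a join of compact elements of $L$, $1$ is compact, and finite products of compact elements of $L$ are compact. An element $p\in L$ with $p<1$ is prime if for all $a,b\in L$, $ab\leqslant p$ implies $a\leqslant p$ or $b\leqslant p$. An $L$-module $M$ is a complete lattice (least element $O_M$, greatest element $I_M$) with a multiplication $L\times M\to M$, $(a,A)\mapsto aA$, such that $(\bigvee_\alpha a_\alpha)A=\bigvee_\alpha a_\alpha A$, $a(\bigvee_\alpha A_\alpha)=\bigvee_\alpha aA_\alpha$, $(ab)A=a(bA)$, $1A=A$, $0A=O_M$. For $A,B\in M$, $(A:B)=\bigvee\{x\in L\mid xB\leqslant A\}\in L$. $N\in M$ is proper if $N<I_M$. A proper $N\in M$ is prime if for all $a\in L$, $X\in M$, $aX\leqslant N$ implies $X\leqslant N$ or $aI_M\leqslant N$. For a proper $N$, $rad(N)=\bigwedge\{P\in M\mid P\text{ is prime and }N\leqslant P\}$ (the empty meet is $I_M$). A proper $N\in M$ is pseudo-primary if for all $a\in L$, $X\in M$, $aX\leqslant N$ implies $a\leqslant (N:I_M)$ or $X\leqslant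 rad(N)$. For a proper $N\in M$, $V((N:I_M))=\{p\in L\mid p\text{ is prime and }(N:I_M)\leqslant p\}$. For a prime $p\in L$ and a proper $N\in M$, the saturation of $N$ with respect to $p$ is $S_p(N)=\bigvee\{X\in M\mid cX\leqslant N\text{ for some }c\in L\text{ with }c\not\leqslant p\}$. *)

theory Defs
  imports Main
begin

class multiplicative_lattice = complete_lattice + comm_monoid_mult +
  assumes one_eq_top: "1 = top"
    and mult_Sup: "a * Sup X = (SUP x\<in>X. a * x)"

text \<open>The finite subset is allowed to be empty, so that the least element is compact.\<close>

definition (in complete_lattice) compact_elt :: "'a \<Rightarrow> bool" where
  "compact_elt a \<longleftrightarrow> (\<forall>X. a \<le> Sup X \<longrightarrow> (\<exists>F. finite F \<and> F \<subseteq> X \<and> a \<le> Sup F))"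

class compact_multiplicative_lattice = multiplicative_lattice +
  assumes join_of_compacts: "\<exists>X. (\<forall>x\<in>X. compact_elt x) \<and> a = Sup X"
    and compact_one: "compact_elt 1"
    and compact_prod: "(\<forall>x\<in>set xs. compact_elt x) \<Longrightarrow> compact_elt (prod_list xs)"

text \<open>The least and greatest elements $O_M$ and $I_M$ of the module are \<^term>\<open>bot\<close> and
  \<^term>\<open>top\<close> of its type; \<open>act a A\<close> is the product $aA$.\<close>

locale lattice_module =
  fixes act :: "'l::multiplicative_lattice \<Rightarrow> 'm::complete_lattice \<Rightarrow> 'm"
  assumes act_Sup_left: "act (Sup S) A = (SUP a\<in>S. act a A)"
    and act_Sup_right: "act a (Sup T) = (SUP A\<in>T. act a A)"
    and act_mult: "act (a * b) A = act a (act b A)"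
    and act_one: "act 1 A = A"
    and act_bot: "act bot A = bot"

definition prime_elt :: "'l::multiplicative_lattice \<Rightarrow> bool" where
  "prime_elt p \<longleftrightarrow> p < 1 \<and> (\<forall>a b. a * b \<le> p \<longrightarrow> a \<le> p \<or> b \<le> p)"

definition residual ::
    "('l::multiplicative_lattice \<Rightarrow> 'm::complete_lattice \<Rightarrow> 'm) \<Rightarrow> 'm \<Rightarrow> 'm \<Rightarrow> 'l" where
  "residual act A B = Sup {x. act x B \<le> A}"

definition proper :: "'m::complete_lattice \<Rightarrow> bool" where
  "proper N \<longleftrightarrow> N < top"

definition prime_module_elt ::
    "('l::multiplicative_lattice \<Rightarrow> 'm::complete_lattice \<Rightarrow> 'm) \<Rightarrow> 'm \<Rightarrow> bool" where
  "prime_module_elt act N \<longleftrightarrow>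
     proper N \<and> (\<forall>a X. act a X \<le> N \<longrightarrow> X \<le> N \<or> act a top \<le> N)"

definition rad ::
    "('l::multiplicative_lattice \<Rightarrow> 'm::complete_lattice \<Rightarrow> 'm) \<Rightarrow> 'm \<Rightarrow> 'm" where
  "rad act N = Inf {P. prime_module_elt act P \<and> N \<le> P}"

definition pseudo_primary ::
    "('l::multiplicative_lattice \<Rightarrow> 'm::complete_lattice \<Rightarrow> 'm) \<Rightarrow> 'm \<Rightarrow> bool" where
  "pseudo_primary act N \<longleftrightarrow>
     proper N \<and> (\<forall>a X. act a X \<le> N \<longrightarrow> a \<le> residual act N top \<or> X \<le> rad act N)"

definition primes_above :: "'l::multiplicative_lattice \<Rightarrow> 'l set" where
  "primes_above a = {p. prime_elt p \<and> a \<le> p}"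

definition saturation ::
    "('l::multiplicative_lattice \<Rightarrow> 'm::complete_lattice \<Rightarrow> 'm) \<Rightarrow> 'l \<Rightarrow> 'm \<Rightarrow> 'm" where
  "saturation act p N = Sup {X. \<exists>c. \<not> c \<le> p \<and> act c X \<le> N}"

end

theory Submission
  imports Defs
begin

text \<open>The radical coincides with the saturation at \<open>p\<close>, so it inherits primeness.
  Pseudo-primarity puts the saturation below the radical (\<open>saturation_le_rad\<close>).
  Conversely, the saturation is a prime element above \<open>N\<close>
  (\<open>le_saturation\<close>), hence one of the elements whose meet is the radical
  (\<open>rad_le_prime\<close>).\<close>

lemma (in lattice_module) le_saturation:
  assumes "prime_elt p"
  shows "N \<le> saturation act p N"
proof -
  \<comment> \<open>The multiplier \<open>c = 1\<close> witnesses that \<open>N\<close> is among the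
    joined elements.\<close>
  have "\<not> 1 \<le> p"
    using assms by (auto simp: prime_elt_def)
  moreover have "act 1 N \<le> N"
    by (simp add: act_one)
  ultimately show ?thesis
    unfolding saturation_def by (blast intro: Sup_upper)
qed

text \<open>Since the residual lies below \<open>p\<close>, a multiplier \<open>c\<close> outside
  \<open>p\<close> is not below the residual. Pseudo-primarity then leaves only
  \<open>X \<le> rad act N\<close> for each joined \<open>X\<close>.\<close>

lemma saturation_le_rad:
  assumes "pseudo_primary act N" and "p \<in> primes_above (residual act N top)"
  shows "saturation act p N \<le> rad act N"
  unfolding saturation_def
proof (rule Sup_least)
  fix X assume "X \<in> {X. \<exists>c. \<not> c \<le> p \<and> act c X \<le> N}"
  then obtain c where c: "\<not> c \<le> p" "act c X \<le> N" by blast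
  have "\<not> c \<le> residual act N top"
    using assms(2) c(1) by (auto simp: primes_above_def intro: order_trans)
  then show "X \<le> rad act N"
    using assms(1) c(2) by (auto simp: pseudo_primary_def)
qed

lemma rad_le_prime:
  assumes "prime_module_elt act P" and "N \<le> P"
  shows "rad act N \<le> P"
  using assms by (auto simp: rad_def intro: Inf_lower)

theorem theorem2p27:
  fixes act :: "'l::compact_multiplicative_lattice \<Rightarrow> 'm::complete_lattice \<Rightarrow> 'm"
    and N :: 'm
  assumes "lattice_module act"
    and "pseudo_primary act N"
    and "\<exists>p \<in> primes_above (residual act N top). prime_module_elt act (saturation act p N)"
  shows "prime_module_elt act (rad act N)"
proof -
  obtain p where p: "p \<in> primes_above (residual act N top)"
    and prime: "prime_module_elt act (saturation act p N)"
    using assms(3) by blast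
  have "N \<le> saturation act p N"
    using lattice_module.le_saturation[OF assms(1)] p by (simp add: primes_above_def)
  \<comment> \<open>Primeness of the saturation gives the inequality from left to right.\<close>
  then have "rad act N = saturation act p N"
    using rad_le_prime[OF prime] saturation_le_rad[OF assms(2) p] by (intro antisym)
  then show ?thesis
    using prime by simp
qed

end
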